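(* Let $T\in\mathcal{K}(V)$ be bisectorial of angle $\omega\in(0,\frac{\pi}{2})$ and let $A\in\mathcal{K}(V)$ be such that $$AQ_s[T]^{-1}\supseteq Q_s[T]^{-1}A\qquad\text{and}\qquad ATQ_s[T]^{-1}\supseteq TQ_s[T]^{-1}A$$ for every $s\in\mathbb{R}^{n+1}\setminus\overline{D_\omega}$. Then for every $\theta\in(\omega,\frac{\pi}{2})$ and every $g\in\mathcal{N}^0(D_\theta)$ one has $$Ag(T)\supseteq g(T)A,$$ where $g(T)$ is given by the $\omega$-functional calculus.
   Context: Clifford setting. Fix an integer $n\geq 1$. $\mathbb{R}_n$ is the real Clifford algebra generated by $e_1,\dots,e_n$ with $e_i^2=-1$, $e_ie_j=-e_je_i$ ($i\neq j$), with basis $e_A=e_{i_1}\cdots e_{i_r}$ for $A=(i_1<\dots<i_r)$, $e_\emptyset=1$, and $|s|^2=\sum_As_A^2$ for $s=\sum_As_Ae_A$. Paravectors: $\mathbb{R}^{n+1}=\{s_0+s_1e_1+\dots+s_ne_n\}\subseteq\mathbb{R}_n$ with $\overline{s}=s_0-s_1e_1-\dots-s_ne_n$. $\mathbb{S}=\{s\in\mathbb{R}^{n+1}: s_0=0,|s|=1\}$ and $\mathbb{C}_J=\{x+Jy: x,y\in\mathbb{R}\}$ for $J\in\mathbb{S}$. $U\subseteq\mathbb{R}^{n+1}$ is axially symmetric if $x+Jy\in U$ ($x,y\in\mathbb{R}$, $J\in\mathbb{S}$) implies $x+Iy\in U$ for all $I\in\mathbb{S}$. Slice hyperholomorphic functions.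 For $U$ open and axially symmetric, $f:U\to\mathbb{R}_n$ is left slice hyperholomorphic ($f\in\mathcal{SH}_L(U)$) if there are continuously differentiable $f_0,f_1:\{(x,y)\in\mathbb{R}^2: x+\mathbb{S}y\subseteq U\}\to\mathbb{R}_n$ with $f(x+Jy)=f_0(x,y)+Jf_1(x,y)$ for all $J\in\mathbb{S}$, $f_0(x,-y)=f_0(x,y)$, $f_1(x,-y)=-f_1(x,y)$, $\partial_xf_0=\partial_yf_1$, $\partial_yf_0=-\partial_xf_1$. If $f_0,f_1$ are real valued, $f$ is called intrinsic ($f\in\mathcal{N}(U)$). Operators. $V_\mathbb{R}$ is a real Banach space, $V=\{\sum_Av_A\otimes e_A: v_A\in V_\mathbb{R}\}$ the corresponding Clifford module with norm $\|v\|^2=\sum_A\|v_A\|^2$ and the natural left and right multiplications by $\mathbb{R}_n$. $\mathcal{B}(V)$: bounded everywhere defined right-linear operators; $\mathcal{K}(V)$: closed right-linear operators $T:\operatorname{dom}(T)\to V$ with right-linear domain $\operatorname{dom}(T)\subseteq V$. A Clifford number $a$ is identified with the operator $v\mapsto av$, so $(aT)v=a(Tv)$, $(Ta)v=T(av)$. For operators, $A\subseteq B$ means $\operatorname{dom}(A)\subseteq\operatorname{dom}(B)$ and $Av=Bv$ for $v\in\operatorname{dom}(A)$; products have their natural domains. For $s\in\mathbb{R}^{n+1}$, $Q_s[T]=T^2-2s_0T+|s|^2$ on $\operatorname{dom}(T^2)$; $\rho_S(T)=\{s\in\mathbb{R}^{n+1}: Q_s[T]^{-1}\in\mathcal{B}(V)\}$,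 $\sigma_S(T)=\mathbb{R}^{n+1}\setminus\rho_S(T)$, and $S_L^{-1}(s,T)=Q_s[T]^{-1}\overline{s}-TQ_s[T]^{-1}$ for $s\in\rho_S(T)$. Bisectorial operators. For $\omega\in(0,\frac{\pi}{2})$, $I_\omega=(-\omega,\omega)\cup(\pi-\omega,\pi+\omega)$ and $D_\omega=\{re^{J\phi}: r>0,\,J\in\mathbb{S},\,\phi\in I_\omega\}\subseteq\mathbb{R}^{n+1}$. $T\in\mathcal{K}(V)$ is bisectorial of angle $\omega$ if $\sigma_S(T)\subseteq\overline{D_\omega}$ and for every $\varphi\in(\omega,\frac{\pi}{2})$ there is $C_\varphi\geq 0$ with $\|S_L^{-1}(s,T)\|\leq\frac{C_\varphi}{|s|}$ for all $s\in\mathbb{R}^{n+1}\setminus(D_\varphi\cup\{0\})$. $\omega$-functional calculus. $\mathcal{SH}_L^0(D_\theta)$ is the set of bounded $f\in\mathcal{SH}_L(D_\theta)$ with $\int_0^\infty|f(te^{J\phi})|\frac{dt}{t}<\infty$ for all $J\in\mathbb{S}$, $\phi\in I_\theta$; $\mathcal{N}^0(D_\theta)$ is the set of intrinsic such functions. For $T$ bisectorial of angle $\omega$, $\theta\in(\omega,\frac{\pi}{2})$ and $f\in\mathcal{SH}_L^0(D_\theta)$, $$f(T)=\frac{1}{2\pi}\int_{\partial D_\varphi\cap\mathbb{C}_J}S_L^{-1}(s,T)ds_Jf(s):=\frac{1}{2\pi}\sum_\pm\int_\mathbb{R}S_L^{-1}(\gamma_\pm(t),T)\frac{\gamma_\pm'(t)}{J}f(\gamma_\pm(t))dt\in\mathcal{B}(V),$$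 with $\gamma_\pm(t)=\pm|t|e^{-\operatorname{sgn}(t)J\varphi}$; it does not depend on the choice of $\varphi\in(\omega,\theta)$ and $J\in\mathbb{S}$. *)

theory Defs
  imports "HOL-Analysis.Analysis"
begin

section \<open>The Clifford algebra and Clifford modules\<close>

text \<open>
  The generators are indexed by a finite linearly ordered type \<open>'n\<close>, so that
  \<open>n = CARD('n) \<ge> 1\<close>, and the basis elements by the subsets of \<open>'n\<close>. The norm of the type
  \<open>'v ^ 'n set\<close> is the Euclidean combination of the norms of the components. Note that the
  operations \<open>*\<close> and \<open>1\<close> of the type \<open>real ^ 'n set\<close> are the componentwise ones and
  are not used here.
\<close>

type_synonym 'n clifford = "(real, 'n set) vec"

type_synonym ('v, 'n) clifford_module = "('v, 'n set) vec"

abbreviation basis_elt :: "'n::finite set \<Rightarrow> 'n clifford" (\<open>\<e>\<close>)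
  where "\<e> A \<equiv> axis A 1"

text \<open>
  \<open>e\<^sub>A e\<^sub>B = reorder_sign A B \<cdot> e\<^sub>C\<close>, where \<open>C\<close> is the symmetric difference of \<open>A\<close> and \<open>B\<close>:
  the pairs with \<open>j < i\<close> count the transpositions which sort the product, those with \<open>j = i\<close>
  the contractions \<open>e\<^sub>i\<^sup>2 = -1\<close>.
\<close>

definition reorder_sign :: "'n::{finite,linorder} set \<Rightarrow> 'n set \<Rightarrow> real"
  where "reorder_sign A B = (- 1) ^ card {(i, j). i \<in> A \<and> j \<in> B \<and> j \<le> i}"

text \<open>
  Left and right multiplication on the module \<open>V = V\<^sub>\<real> \<otimes> \<real>\<^sub>n\<close>. For \<open>'v = real\<close>, the module is
  the Clifford algebra, and \<open>\<odot>\<close> is its product.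
\<close>

definition lmul :: "'n::{finite,linorder} clifford \<Rightarrow> ('v::real_vector, 'n) clifford_module \<Rightarrow>
    ('v, 'n) clifford_module" (infixr \<open>\<odot>\<close> 75)
  where "a \<odot> v =
    (\<Sum>A\<in>UNIV. \<Sum>B\<in>UNIV. axis (sym_diff A B) ((reorder_sign A B * a $ A) *\<^sub>R v $ B))"

definition rmul :: "('v::real_vector, 'n) clifford_module \<Rightarrow> 'n::{finite,linorder} clifford \<Rightarrow>
    ('v, 'n) clifford_module" (infixl \<open>\<odot>\<^sub>R\<close> 75)
  where "v \<odot>\<^sub>R a =
    (\<Sum>A\<in>UNIV. \<Sum>B\<in>UNIV. axis (sym_diff B A) ((reorder_sign B A * a $ A) *\<^sub>R v $ B))"

lemma lmul_basis: "\<e> A \<odot> axis B v = axis (sym_diff A B) (reorder_sign A B *\<^sub>R v)"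
proof -
  have "(\<Sum>B'\<in>UNIV. axis (sym_diff A' B') ((reorder_sign A' B' * \<e> A $ A') *\<^sub>R axis B v $ B')) =
    (if A' = A then axis (sym_diff A B) (reorder_sign A B *\<^sub>R v) else 0)" for A'
  proof -
    have "(\<Sum>B'\<in>UNIV. axis (sym_diff A' B') ((reorder_sign A' B' * \<e> A $ A') *\<^sub>R axis B v $ B')) =
      (\<Sum>B'\<in>UNIV. if B' = B then
         axis (sym_diff A' B) ((reorder_sign A' B * \<e> A $ A') *\<^sub>R v) else 0)"
      by (intro sum.cong) (auto simp: axis_def vec_eq_iff)
    also have "\<dots> = axis (sym_diff A' B) ((reorder_sign A' B * \<e> A $ A') *\<^sub>R v)"
      by simp
    also have "\<dots> = (if A' = A then axis (sym_diff A B) (reorder_sign A B *\<^sub>R v) else 0)"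
      by (auto simp: axis_def vec_eq_iff)
    finally show ?thesis .
  qed
  then show ?thesis
    by (simp add: lmul_def)
qed

lemma rmul_basis: "axis B v \<odot>\<^sub>R \<e> A = axis (sym_diff B A) (reorder_sign B A *\<^sub>R v)"
proof -
  have "(\<Sum>B'\<in>UNIV. axis (sym_diff B' A') ((reorder_sign B' A' * \<e> A $ A') *\<^sub>R axis B v $ B')) =
    (if A' = A then axis (sym_diff B A) (reorder_sign B A *\<^sub>R v) else 0)" for A'
  proof -
    have "(\<Sum>B'\<in>UNIV. axis (sym_diff B' A') ((reorder_sign B' A' * \<e> A $ A') *\<^sub>R axis B v $ B')) =
      (\<Sum>B'\<in>UNIV. if B' = B then
         axis (sym_diff B A') ((reorder_sign B A' * \<e> A $ A') *\<^sub>R v) else 0)"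
      by (intro sum.cong) (auto simp: axis_def vec_eq_iff)
    also have "\<dots> = axis (sym_diff B A') ((reorder_sign B A' * \<e> A $ A') *\<^sub>R v)"
      by simp
    also have "\<dots> = (if A' = A then axis (sym_diff B A) (reorder_sign B A *\<^sub>R v) else 0)"
      by (auto simp: axis_def vec_eq_iff)
    finally show ?thesis .
  qed
  then show ?thesis
    by (simp add: rmul_def)
qed

lemma generator_square: "\<e> {i} \<odot> \<e> {i} = - \<e> {}"
proof -
  have "{(k, j). k \<in> {i} \<and> j \<in> {i} \<and> j \<le> k} = {(i, i)}" by auto
  then show ?thesis
    unfolding lmul_basis reorder_sign_def by (simp add: axis_def vec_eq_iff)
qed

lemma generators_anticommute:
  assumes "i \<noteq> j"
  shows "\<e> {i} \<odot> \<e> {j} = - (\<e> {j} \<odot> \<e> {i})"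
proof -
  have *: "{(k, l). k \<in> {a} \<and> l \<in> {b} \<and> l \<le> k} = (if b \<le> a then {(a, b)} else {})" for a b :: 'a
    by auto
  show ?thesis
    using assms unfolding lmul_basis reorder_sign_def *
    by (auto simp: axis_def vec_eq_iff)
qed

lemma basis_elt_insert:
  assumes "\<And>j. j \<in> A \<Longrightarrow> i < j"
  shows "\<e> (insert i A) = \<e> {i} \<odot> \<e> A"
proof -
  have *: "{(k, j). k \<in> {i} \<and> j \<in> A \<and> j \<le> k} = {}" "sym_diff {i} A = insert i A"
    using assms by fastforce+
  show ?thesis unfolding lmul_basis reorder_sign_def * by simp
qed

lemma reorder_sign_eq_prod:
  "reorder_sign A B = (\<Prod>i\<in>A. \<Prod>j\<in>B. if j \<le> i then - 1 else 1)"
proof -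
  have "{(i, j). i \<in> A \<and> j \<in> B \<and> j \<le> i} = A \<times> B \<inter> {p. snd p \<le> fst p}"
    by auto
  then have "reorder_sign A B = (\<Prod>p\<in>A \<times> B. if snd p \<le> fst p then - 1 else 1)"
    by (simp add: reorder_sign_def prod.If_cases)
  then show ?thesis
    by (simp add: prod.cartesian_product case_prod_unfold)
qed

lemma prod_sym_diff:
  fixes f :: "'n::finite \<Rightarrow> real"
  assumes "\<And>i. f i * f i = 1"
  shows "prod f (sym_diff A B) = prod f A * prod f B"
proof -
  have "prod f A = prod f (A - B) * prod f (A \<inter> B)" "prod f B = prod f (B - A) * prod f (A \<inter> B)"
    by (subst prod.union_disjoint[symmetric]; (simp | rule arg_cong[where f = "prod f"] | blast)+)+
  moreover have "prod f (A \<inter> B) * prod f (A \<inter> B) = 1"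
    using assms by (simp flip: prod.distrib)
  moreover have "prod f (sym_diff A B) = prod f (A - B) * prod f (B - A)"
    by (rule prod.union_disjoint) auto
  ultimately show ?thesis by (simp add: mult_ac)
qed

lemma reorder_sign_cocycle:
  "reorder_sign A B * reorder_sign (sym_diff A B) C =
   reorder_sign B C * reorder_sign A (sym_diff B C)"
proof -
  have 1: "reorder_sign (sym_diff A B) C = reorder_sign A C * reorder_sign B C"
    unfolding reorder_sign_eq_prod
    by (rule prod_sym_diff) (auto simp flip: prod.distrib intro!: prod.neutral)
  have 2: "reorder_sign A (sym_diff B C) = reorder_sign A B * reorder_sign A C"
    unfolding reorder_sign_eq_prod prod.distrib[symmetric]
    by (intro prod.cong refl prod_sym_diff) auto
  show ?thesis by (simp add: 1 2)
qed

lemma linear_lmul: "linear (\<lambda>v. a \<odot> v)"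
  by (rule linearI)
    (auto simp: lmul_def axis_def vec_eq_iff sum.distrib[symmetric] scaleR_add_right scaleR_sum_right
       intro!: sum.cong)

lemma linear_lmul_left: "linear (\<lambda>a. a \<odot> v)"
  by (rule linearI)
    (auto simp: lmul_def axis_def vec_eq_iff sum.distrib[symmetric] scaleR_add_left scaleR_sum_right
       distrib_left intro!: sum.cong)

lemma axis_expansion: "(v :: ('v::real_vector, 'n::finite) clifford_module) = (\<Sum>A\<in>UNIV. axis A (v $ A))"
  by (auto simp: vec_eq_iff axis_def if_distrib cong: if_cong)

lemma basis_expansion_clifford: "(a :: 'n::finite clifford) = (\<Sum>A\<in>UNIV. a $ A *\<^sub>R \<e> A)"
  by (auto simp: vec_eq_iff axis_def if_distrib cong: if_cong)

lemma lmul_assoc: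
  fixes v :: "('v::real_vector, 'n::{finite,linorder}) clifford_module"
  shows "(a \<odot> b) \<odot> v = a \<odot> (b \<odot> v)"
proof -
  have basis: "(\<e> A \<odot> \<e> B) \<odot> axis C w = \<e> A \<odot> (\<e> B \<odot> axis C w)" for A B C and w :: 'v
  proof -
    have "\<e> A \<odot> \<e> B = reorder_sign A B *\<^sub>R \<e> (sym_diff A B)"
      unfolding lmul_basis by (simp add: vec_eq_iff axis_def)
    then have "(\<e> A \<odot> \<e> B) \<odot> axis C w =
        reorder_sign A B *\<^sub>R (\<e> (sym_diff A B) \<odot> axis C w)"
      by (simp add: linear_scale[OF linear_lmul_left])
    also have "\<dots> = axis (sym_diff (sym_diff A B) C)
        ((reorder_sign A B * reorder_sign (sym_diff A B) C) *\<^sub>R w)"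
      unfolding lmul_basis by (simp add: vec_eq_iff axis_def)
    also have "sym_diff (sym_diff A B) C = sym_diff A (sym_diff B C)" by blast
    also have "axis \<dots> ((reorder_sign A B * reorder_sign (sym_diff A B) C) *\<^sub>R w) =
        \<e> A \<odot> (\<e> B \<odot> axis C w)"
      by (simp add: lmul_basis reorder_sign_cocycle mult.commute)
    finally show ?thesis .
  qed
  have 1: "(\<e> A \<odot> \<e> B) \<odot> v = \<e> A \<odot> (\<e> B \<odot> v)" for A B
    by (subst (1 2) axis_expansion[of v]) (simp only: linear_sum[OF linear_lmul] basis)
  have 2: "(\<e> A \<odot> b) \<odot> v = \<e> A \<odot> (b \<odot> v)" for A
    by (subst (1 2) basis_expansion_clifford[of b])
      (simp only: linear_sum[OF linear_lmul] linear_sum[OF linear_lmul_left]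
        linear_scale[OF linear_lmul] linear_scale[OF linear_lmul_left] 1)
  show ?thesis
    by (subst (1 2) basis_expansion_clifford[of a])
      (simp only: linear_sum[OF linear_lmul_left] linear_scale[OF linear_lmul_left] 2)
qed


section \<open>Paravectors\<close>

definition paravectors :: "'n::finite clifford set"
  where "paravectors = {s0 *\<^sub>R \<e> {} + (\<Sum>i\<in>UNIV. x i *\<^sub>R \<e> {i}) | s0 x. True}"

text \<open>Conjugation, used on paravectors only.\<close>

definition pconj :: "'n::finite clifford \<Rightarrow> 'n clifford"
  where "pconj s = s $ {} *\<^sub>R \<e> {} - (\<Sum>i\<in>UNIV. s $ {i} *\<^sub>R \<e> {i})"

definition unit_sphere :: "'n::finite clifford set" (\<open>\<S>\<close>)
  where "\<S> = {s \<in> paravectors. s $ {} = 0 \<and> norm s = 1}"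

text \<open>\<open>e\<^bsup>J\<phi>\<^esup>\<close> for \<open>J \<in> \<S>\<close>\<close>

definition cexp :: "'n::finite clifford \<Rightarrow> real \<Rightarrow> 'n clifford"
  where "cexp J \<phi> = cos \<phi> *\<^sub>R \<e> {} + sin \<phi> *\<^sub>R J"


section \<open>Slice hyperholomorphic functions\<close>

definition slice_domain :: "'n::finite clifford set \<Rightarrow> (real \<times> real) set"
  where "slice_domain U = {(x, y). \<forall>J\<in>\<S>. x *\<^sub>R \<e> {} + y *\<^sub>R J \<in> U}"

definition C1_on :: "('a::real_normed_vector \<Rightarrow> 'b::real_normed_vector) \<Rightarrow> 'a set \<Rightarrow> bool"
  where "C1_on f U \<longleftrightarrow>
    (\<exists>f'. (\<forall>x\<in>U. (f has_derivative blinfun_apply (f' x)) (at x)) \<and> continuous_on U f')"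

text \<open>
  \<open>f\<^sub>0\<close> and \<open>f\<^sub>1\<close> represent the left slice hyperholomorphic function \<open>f\<close> on \<open>U\<close>. This and the
  following notions are meant for axially symmetric sets \<open>U\<close> that are open in \<open>paravectors\<close>,
  such as the double sectors below.
\<close>

definition slice_components :: "'n::{finite,linorder} clifford set \<Rightarrow> ('n clifford \<Rightarrow> 'n clifford) \<Rightarrow>
    (real \<times> real \<Rightarrow> 'n clifford) \<Rightarrow> (real \<times> real \<Rightarrow> 'n clifford) \<Rightarrow> bool"
  where "slice_components U f f0 f1 \<longleftrightarrow>
    C1_on f0 (slice_domain U) \<and> C1_on f1 (slice_domain U) \<and>
    (\<forall>(x, y)\<in>slice_domain U.
      (\<forall>J\<in>\<S>. f (x *\<^sub>R \<e> {} + y *\<^sub>R J) = f0 (x, y) + J \<odot> f1 (x, y)) \<and>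
      f0 (x, - y) = f0 (x, y) \<and> f1 (x, - y) = - f1 (x, y) \<and>
      vector_derivative (\<lambda>t. f0 (t, y)) (at x) = vector_derivative (\<lambda>t. f1 (x, t)) (at y) \<and>
      vector_derivative (\<lambda>t. f0 (x, t)) (at y) = - vector_derivative (\<lambda>t. f1 (t, y)) (at x))"

definition SH_L :: "'n::{finite,linorder} clifford set \<Rightarrow> ('n clifford \<Rightarrow> 'n clifford) set"
  where "SH_L U = {f. \<exists>f0 f1. slice_components U f f0 f1}"

definition intrinsic :: "'n::{finite,linorder} clifford set \<Rightarrow> ('n clifford \<Rightarrow> 'n clifford) set"
  where "intrinsic U = {f. \<exists>f0 f1. slice_components U f f0 f1 \<and>
    (\<forall>p\<in>slice_domain U. f0 p \<in> range (\<lambda>r. r *\<^sub>R \<e> {}) \<and> f1 p \<in> range (\<lambda>r. r *\<^sub>R \<e> {}))}"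


section \<open>Operators\<close>

text \<open>
  An operator is a partial map. Its domain is \<open>dom T\<close>, the product \<open>AB\<close> with its natural domain
  is \<open>A \<circ>\<^sub>m B\<close>, and the inclusion of operators is \<open>\<subseteq>\<^sub>m\<close>.
\<close>

type_synonym ('v, 'n) clifford_operator =
  "('v, 'n) clifford_module \<rightharpoonup> ('v, 'n) clifford_module"

definition right_linear ::
    "('v::real_vector, 'n::{finite,linorder}) clifford_operator \<Rightarrow> bool"
  where "right_linear T \<longleftrightarrow>
    T 0 = Some 0 \<and>
    (\<forall>v w v' w'. T v = Some v' \<longrightarrow> T w = Some w' \<longrightarrow> T (v + w) = Some (v' + w')) \<and>
    (\<forall>v v' a. T v = Some v' \<longrightarrow> T (v \<odot>\<^sub>R a) = Some (v' \<odot>\<^sub>R a))"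

definition bounded_ops :: "('v::real_normed_vector, 'n::{finite,linorder}) clifford_operator set"
  where "bounded_ops = {T. right_linear T \<and> dom T = UNIV \<and> bounded_linear (\<lambda>v. the (T v))}"

definition closed_ops :: "('v::real_normed_vector, 'n::{finite,linorder}) clifford_operator set"
  where "closed_ops = {T. right_linear T \<and> closed (Map.graph T)}"

definition mult_op :: "'n::{finite,linorder} clifford \<Rightarrow> ('v::real_vector, 'n) clifford_operator"
  where "mult_op a = (\<lambda>v. Some (a \<odot> v))"

definition op_diff :: "('v::real_vector, 'n::finite) clifford_operator \<Rightarrow>
    ('v, 'n) clifford_operator \<Rightarrow> ('v, 'n) clifford_operator"
  where "op_diff A B =
    (\<lambda>v. if v \<in> dom A \<inter> dom B then Some (the (A v) - the (B v)) else None)"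

text \<open>The inverse, defined on the range; meaningful only for injective operators.\<close>

definition op_inverse ::
    "('v, 'n) clifford_operator \<Rightarrow> ('v, 'n) clifford_operator"
  where "op_inverse T =
    (\<lambda>w. if \<exists>v. T v = Some w then Some (THE v. T v = Some w) else None)"

definition Q_op :: "'n::{finite,linorder} clifford \<Rightarrow> ('v::real_vector, 'n) clifford_operator \<Rightarrow>
    ('v, 'n) clifford_operator"
  where "Q_op s T = (\<lambda>v. if v \<in> dom (T \<circ>\<^sub>m T)
    then Some (the ((T \<circ>\<^sub>m T) v) - (2 * s $ {}) *\<^sub>R the (T v) + (norm s)\<^sup>2 *\<^sub>R v)
    else None)"

abbreviation Q_inv :: "'n::{finite,linorder} clifford \<Rightarrow> ('v::real_vector, 'n) clifford_operator \<Rightarrow>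
    ('v, 'n) clifford_operator"
  where "Q_inv s T \<equiv> op_inverse (Q_op s T)"

definition S_resolvent_set ::
    "('v::real_normed_vector, 'n::{finite,linorder}) clifford_operator \<Rightarrow> 'n clifford set"
  where "S_resolvent_set T =
    {s \<in> paravectors. inj_on (Q_op s T) (dom (Q_op s T)) \<and> Q_inv s T \<in> bounded_ops}"

definition S_spectrum ::
    "('v::real_normed_vector, 'n::{finite,linorder}) clifford_operator \<Rightarrow> 'n clifford set"
  where "S_spectrum T = paravectors - S_resolvent_set T"

definition left_S_resolvent :: "'n::{finite,linorder} clifford \<Rightarrow>
    ('v::real_vector, 'n) clifford_operator \<Rightarrow> ('v, 'n) clifford_operator"
  where "left_S_resolvent s T = op_diff (Q_inv s T \<circ>\<^sub>m mult_op (pconj s)) (T \<circ>\<^sub>m Q_inv s T)"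


section \<open>Bisectorial operators and the \<open>\<omega>\<close>-functional calculus\<close>

definition sector_angles :: "real \<Rightarrow> real set"
  where "sector_angles \<omega> = {- \<omega><..<\<omega>} \<union> {pi - \<omega><..<pi + \<omega>}"

definition double_sector :: "real \<Rightarrow> 'n::finite clifford set"
  where "double_sector \<omega> = {r *\<^sub>R cexp J \<phi> | r J \<phi>. r > 0 \<and> J \<in> \<S> \<and> \<phi> \<in> sector_angles \<omega>}"

text \<open>
  For closed \<open>T\<close> and \<open>s\<close> in the S-resolvent set, \<open>left_S_resolvent s T\<close> is always in
  \<open>bounded_ops\<close> (closed graph theorem). Membership is stated together with the estimate because
  \<open>onorm\<close> is the operator norm of bounded operators only.
\<close>

definition bisectorial ::
    "real \<Rightarrow> ('v::banach, 'n::{finite,linorder}) clifford_operator \<Rightarrow> bool"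
  where "bisectorial \<omega> T \<longleftrightarrow>
    T \<in> closed_ops \<and>
    S_spectrum T \<subseteq> closure (double_sector \<omega>) \<and>
    (\<forall>\<phi>\<in>{\<omega><..<pi / 2}. \<exists>C\<ge>0. \<forall>s\<in>paravectors - (double_sector \<phi> \<union> {0}).
      left_S_resolvent s T \<in> bounded_ops \<and>
      onorm (\<lambda>v. the (left_S_resolvent s T v)) \<le> C / norm s)"

definition SH_L0 :: "real \<Rightarrow> ('n::{finite,linorder} clifford \<Rightarrow> 'n clifford) set"
  where "SH_L0 \<theta> = {f \<in> SH_L (double_sector \<theta>).
    bounded (f ` double_sector \<theta>) \<and>
    (\<forall>J\<in>\<S>. \<forall>\<phi>\<in>sector_angles \<theta>.
      (\<integral>\<^sup>+t\<in>{0<..}. ennreal (norm (f (t *\<^sub>R cexp J \<phi>)) / t) \<partial>lborel) < \<infinity>)}"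

definition N0 :: "real \<Rightarrow> ('n::{finite,linorder} clifford \<Rightarrow> 'n clifford) set"
  where "N0 \<theta> = SH_L0 \<theta> \<inter> intrinsic (double_sector \<theta>)"

text \<open>The curves \<open>\<gamma>\<^sub>\<plusminus>\<close>, with \<open>\<sigma> = 1\<close> and \<open>\<sigma> = -1\<close> for the sign\<close>

definition bisector_path :: "real \<Rightarrow> 'n::finite clifford \<Rightarrow> real \<Rightarrow> real \<Rightarrow> 'n clifford"
  where "bisector_path \<sigma> J \<phi> t = (\<sigma> * \<bar>t\<bar>) *\<^sub>R cexp J (- (sgn t * \<phi>))"

text \<open>
  The integral is the Henstock-Kurzweil integral in the Banach space of bounded operators with
  the operator norm (the Bochner integral of the library needs a separable space). The factor
  \<open>1/J\<close> is \<open>- J\<close>, because \<open>J\<^sup>2 = -1\<close>. At \<open>t = 0\<close> the integrand has no meaning, but its value there is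
  irrelevant.
\<close>

definition omega_calculus :: "real \<Rightarrow> 'n clifford \<Rightarrow> ('n clifford \<Rightarrow> 'n clifford) \<Rightarrow>
    ('v::banach, 'n::{finite,linorder}) clifford_operator \<Rightarrow>
    ('v, 'n) clifford_module \<Rightarrow>\<^sub>L ('v, 'n) clifford_module"
  where "omega_calculus \<phi> J f T = (1 / (2 * pi)) *\<^sub>R (\<Sum>\<sigma>\<in>{1, - 1}.
    integral UNIV (\<lambda>t.
      let s = bisector_path \<sigma> J \<phi> t;
          ds = vector_derivative (bisector_path \<sigma> J \<phi>) (at t) \<odot> (- J)
      in Blinfun (\<lambda>v. the ((left_S_resolvent s T \<circ>\<^sub>m mult_op ds \<circ>\<^sub>m mult_op (f s)) v))))"

definition op_of_blinfun :: "('v::real_normed_vector, 'n::finite) clifford_module \<Rightarrow>\<^sub>L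
    ('v, 'n) clifford_module \<Rightarrow> ('v, 'n) clifford_operator"
  where "op_of_blinfun F = (\<lambda>v. Some (blinfun_apply F v))"

end

theory Submission
  imports Defs
begin

text \<open>
  Conjugating \<open>s \<in> \<complex>\<^sub>J\<close> conjugates \<open>ds\<^sub>J\<close> and, for intrinsic \<open>g\<close>, also \<open>g(s)\<close>. The parameters \<open>t\<close> and \<open>-t\<close>
  give conjugate points of the path, so folding the integral at \<open>0\<close> leaves an integrand
  \<open>c Q\<^sub>s[T]\<^sup>-\<^sup>1 + d T Q\<^sub>s[T]\<^sup>-\<^sup>1\<close> with real \<open>c\<close> and \<open>d\<close>, which commutes with \<open>A\<close>. For \<open>A v = w\<close>, the
  bounded operators \<open>B\<close> with \<open>A (B v) = B w\<close> form a closed subspace, because \<open>A\<close> is closed;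
  it contains the integrand, hence also the integral.
\<close>

section \<open>Integrals with values in a closed subspace, and reflection\<close>

text \<open>Riemann sums are finite real combinations of values of the integrand, so they stay in
  \<open>M\<close>, and a closed set keeps their limits. This carries linear relations from an
  operator-valued integrand over to its integral.\<close>

lemma has_integral_in_closed_subspace:
  fixes f :: "'n::euclidean_space \<Rightarrow> 'a::real_normed_vector"
  assumes f: "(f has_integral I) S" and fM: "\<And>x. x \<in> S \<Longrightarrow> f x \<in> M"
    and M: "subspace M" "closed M"
  shows "I \<in> M"
proof -
  have cbox: "z \<in> M" if "(h has_integral z) (cbox a b)" "\<And>x. h x \<in> M" for h z a b
    using M(2) _ division_filter_not_empty that(1)[unfolded has_integral_cbox]
    by (rule Lim_in_closed_set)
      (auto intro!: always_eventually subspace_sum[OF M(1)] subspace_scale[OF M(1)] that(2))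
  let ?f = "\<lambda>x. if x \<in> S then f x else 0"
  have fM': "?f x \<in> M" for x
    using fM subspace_0[OF M(1)] by auto
  \<comment> \<open>Over a box the integral is itself a limit of Riemann sums. Over any other set it
    is approximated by integrals of the zero extension over large boxes, and the added value 0 lies
    in \<open>M\<close>.\<close>
  show ?thesis
  proof (cases "\<exists>a b. S = cbox a b")
    case True
    then obtain a b where S: "S = cbox a b" by blast
    have "(?f has_integral I) (cbox a b)"
      using f has_integral_eq[of S f ?f I] by (simp add: S)
    then show ?thesis
      using fM' by (rule cbox)
  next
    case False
    have "\<exists>z\<in>M. dist z I < e" if "e > 0" for e
    proof -
      from f False \<open>e > 0\<close> obtain B where B: "\<forall>a b. ball 0 B \<subseteq> cbox a b \<longrightarrow>
          (\<exists>z. (?f has_integral z) (cbox a b) \<and> norm (z - I) < e)"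
        by (rule has_integral_altD) blast
      obtain a :: 'n where "ball 0 B \<subseteq> cbox (- a) a"
        using bounded_subset_cbox_symmetric[OF bounded_ball] by blast
      with B obtain z where "(?f has_integral z) (cbox (- a) a)" "norm (z - I) < e"
        by blast
      with cbox[OF this(1) fM'] show ?thesis
        by (auto simp: dist_norm)
    qed
    then have "I \<in> closure M"
      by (simp add: closure_approachable)
    then show ?thesis
      using M(2) by simp
  qed
qed

text \<open>Reflection is known on boxes; it passes to the whole space because a centred ball is
  symmetric, so a box contains it whenever the reflected box does.\<close>

lemma has_integral_reflect_UNIV:
  fixes f :: "'n::euclidean_space \<Rightarrow> 'a::banach"
  assumes "(f has_integral I) UNIV"
  shows "((\<lambda>x. f (- x)) has_integral I) UNIV"
  unfolding has_integral'[where S = UNIV]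
proof (intro allI impI)
  fix e :: real
  assume "e > 0"
  with assms obtain B where B: "B > 0" "\<And>a b. ball 0 B \<subseteq> cbox a b \<Longrightarrow>
      \<exists>z. (f has_integral z) (cbox a b) \<and> norm (z - I) < e"
    unfolding has_integral'[where S = UNIV] by auto
  have "\<exists>z. ((\<lambda>x. f (- x)) has_integral z) (cbox a b) \<and> norm (z - I) < e"
    if "ball 0 B \<subseteq> cbox a b" for a b
  proof -
    have "x \<in> cbox (- b) (- a)" if "x \<in> ball 0 B" for x
    proof -
      have "- x \<in> cbox a b"
        using that \<open>ball 0 B \<subseteq> cbox a b\<close> by (auto simp: subset_iff)
      then show ?thesis
        by (force simp: mem_box)
    qed
    then obtain z where "(f has_integral z) (cbox (- b) (- a))" "norm (z - I) < e"
      using B(2) by blast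
    then show ?thesis
      using has_integral_reflect[of f z "- a" "- b"] by auto
  qed
  with B(1) show "\<exists>B>0. \<forall>a b. ball 0 B \<subseteq> cbox a b \<longrightarrow>
      (\<exists>z. ((\<lambda>x. if x \<in> UNIV then f (- x) else 0) has_integral z) (cbox a b) \<and> norm (z - I) < e)"
    by auto
qed

section \<open>Clifford multiplication and the planes \<open>\<complex>\<^sub>J\<close>\<close>

lemma lmul_one: "\<e> {} \<odot> v = v"
proof -
  have "\<e> {} \<odot> v = (\<Sum>B\<in>UNIV. \<e> {} \<odot> axis B (v $ B))"
    by (subst (1) axis_expansion[of v]) (simp only: linear_sum[OF linear_lmul])
  also have "\<dots> = (\<Sum>B\<in>UNIV. axis B (v $ B))"
    unfolding lmul_basis by (simp add: reorder_sign_def)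
  finally show ?thesis
    by (simp flip: axis_expansion)
qed

text \<open>The bridge from right linearity over the Clifford algebra to real homogeneity of
  operators.\<close>

lemma rmul_real: "v \<odot>\<^sub>R (c *\<^sub>R \<e> {}) = c *\<^sub>R v"
proof -
  have "(\<Sum>B\<in>UNIV. axis (sym_diff B A) ((reorder_sign B A * (c *\<^sub>R \<e> {}) $ A) *\<^sub>R v $ B)) =
    (if A = {} then c *\<^sub>R v else 0)" for A
    by (cases "A = {}") (auto simp: axis_def vec_eq_iff reorder_sign_def if_distrib cong: if_cong)
  then show ?thesis
    by (simp add: rmul_def)
qed

text \<open>Ensures that \<open>Blinfun\<close> in the integrand is applied to a bounded linear map.
  The product is a finite sum of coordinate projections, scalings and axis embeddings.\<close>

lemma bounded_linear_lmul:
  "bounded_linear (\<lambda>v :: ('v::real_normed_vector, 'n::{finite,linorder}) clifford_module. a \<odot> v)"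
proof -
  have "bounded_linear (\<lambda>x :: 'v. axis k x :: ('v, 'n) clifford_module)" for k
  proof (rule bounded_linear_intro[where K = 1])
    show "norm (axis k x :: ('v, 'n) clifford_module) \<le> norm x * 1" for x :: 'v
      by (auto simp: norm_vec_def L2_set_def axis_def if_distrib[of norm] if_distrib[of "\<lambda>x. x\<^sup>2"] cong: if_cong)
  qed (auto simp: axis_def vec_eq_iff)
  note axis = bounded_linear_compose[OF this
      bounded_linear_compose[OF bounded_linear_scaleR_right bounded_linear_vec_nth]]
  then show ?thesis
    unfolding lmul_def by (intro bounded_linear_sum axis)
qed

lemma generator_sum_nth:
  fixes x :: "'n::finite \<Rightarrow> real"
  shows "(\<Sum>i\<in>UNIV. x i *\<^sub>R \<e> {i}) $ {} = 0" "(\<Sum>i\<in>UNIV. x i *\<^sub>R \<e> {i}) $ {j} = x j"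
  by (simp_all add: axis_def if_distrib cong: if_cong)

lemma unit_sphereE:
  assumes "J \<in> \<S>"
  obtains x where "J = (\<Sum>i\<in>UNIV. x i *\<^sub>R \<e> {i})" "(\<Sum>i\<in>UNIV. (x i)\<^sup>2) = 1"
proof -
  obtain s x where J: "J = s *\<^sub>R \<e> {} + (\<Sum>i\<in>UNIV. x i *\<^sub>R \<e> {i})" "J $ {} = 0" "norm J = 1"
    using assms by (auto simp: unit_sphere_def paravectors_def)
  then have "s = 0"
    using generator_sum_nth(1)[of x] by simp
  with J have Jx: "J = (\<Sum>i\<in>UNIV. x i *\<^sub>R \<e> {i})"
    by simp
  have "1 = inner J J"
    using J(3) by (simp add: dot_square_norm)
  also have "\<dots> = (\<Sum>i\<in>UNIV. x i * inner J (\<e> {i}))"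
    by (subst (2) Jx) (simp add: inner_sum_right)
  also have "\<dots> = (\<Sum>i\<in>UNIV. (x i)\<^sup>2)"
    using generator_sum_nth(2)[of x] by (simp add: inner_axis power2_eq_square flip: Jx)
  finally show thesis
    using that Jx by simp
qed

lemma unit_sphere_square:
  assumes "J \<in> \<S>"
  shows "J \<odot> J = - \<e> {}"
proof -
  obtain x where J: "J = (\<Sum>i\<in>UNIV. x i *\<^sub>R \<e> {i})" and x: "(\<Sum>i\<in>UNIV. (x i)\<^sup>2) = 1"
    using assms by (rule unit_sphereE)
  let ?e = "\<lambda>i j. (x i * x j) *\<^sub>R (\<e> {i} \<odot> \<e> {j})"
  have eq: "J \<odot> J = (\<Sum>i\<in>UNIV. \<Sum>j\<in>UNIV. ?e i j)"
    unfolding J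
    by (simp only: linear_sum[OF linear_lmul] linear_sum[OF linear_lmul_left]
        linear_scale[OF linear_lmul] linear_scale[OF linear_lmul_left] scaleR_scaleR scaleR_sum_right)
      (subst sum.swap, simp add: mult.commute)
  \<comment> \<open>Adding the double sum to its transpose pairs each mixed product with its
    opposite, which cancels by anticommutativity; only the diagonal survives.\<close>
  have "J \<odot> J + J \<odot> J = (\<Sum>i\<in>UNIV. \<Sum>j\<in>UNIV. ?e i j + ?e j i)"
    by (simp only: eq sum.distrib) (subst (4) sum.swap, rule refl)
  also have "\<dots> = (\<Sum>i\<in>UNIV. \<Sum>j\<in>UNIV. if j = i then (- 2 * (x i)\<^sup>2) *\<^sub>R \<e> {} else 0)"
  proof (intro sum.cong refl)
    fix i j
    show "?e i j + ?e j i = (if j = i then (- 2 * (x i)\<^sup>2) *\<^sub>R \<e> {} else 0)"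
      using generators_anticommute[of i j]
      by (auto simp: generator_square mult.commute power2_eq_square simp flip: scaleR_2)
  qed
  also have "\<dots> = (- 2 * (\<Sum>i\<in>UNIV. (x i)\<^sup>2)) *\<^sub>R \<e> {}"
    by (simp add: sum_distrib_left scaleR_sum_left)
  also have "\<dots> = - \<e> {} + - \<e> {}"
    by (simp add: x vec_eq_iff axis_def)
  finally have "2 *\<^sub>R (J \<odot> J) = 2 *\<^sub>R (- \<e> {})"
    unfolding scaleR_2 .
  then show ?thesis by (simp only: scaleR_cancel_left) simp
qed

text \<open>Real coordinates on the plane \<open>\<complex>\<^sub>J\<close>, in which conjugation is
  \<open>y \<mapsto> - y\<close> and products become real arithmetic.\<close>

definition slice_point :: "'n::finite clifford \<Rightarrow> real \<Rightarrow> real \<Rightarrow> 'n clifford"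
  where "slice_point J x y = x *\<^sub>R \<e> {} + y *\<^sub>R J"

lemma slice_point_lmul: "slice_point J x y \<odot> v = x *\<^sub>R v + y *\<^sub>R (J \<odot> v)"
  by (simp add: slice_point_def linear_add[OF linear_lmul_left] linear_scale[OF linear_lmul_left]
      lmul_one)

text \<open>Since \<open>J\<close> squares to -1, left multiplications by elements of
  \<open>\<complex>\<^sub>J\<close> compose like complex numbers.\<close>

lemma slice_point_mult:
  assumes "J \<in> \<S>"
  shows "slice_point J a b \<odot> (slice_point J c d \<odot> v) =
    slice_point J (a * c - b * d) (a * d + b * c) \<odot> v"
proof -
  have "J \<odot> (J \<odot> v) = - v"
    by (simp add: unit_sphere_square[OF assms] lmul_one linear_neg[OF linear_lmul_left]
        flip: lmul_assoc)
  then show ?thesis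
    by (simp add: slice_point_lmul linear_add[OF linear_lmul] linear_scale[OF linear_lmul]
        algebra_simps)
qed

lemma unit_sphere_nth_empty: "J \<in> \<S> \<Longrightarrow> J $ {} = 0"
  by (simp add: unit_sphere_def)

lemma slice_point_nth_empty: "J \<in> \<S> \<Longrightarrow> slice_point J x y $ {} = x"
  by (simp add: slice_point_def unit_sphere_nth_empty axis_def)

lemma norm_slice_point:
  assumes "J \<in> \<S>"
  shows "norm (slice_point J x y) = sqrt (x\<^sup>2 + y\<^sup>2)"
proof -
  have "inner J J = 1"
    using assms by (simp add: unit_sphere_def dot_square_norm)
  then show ?thesis
    using unit_sphere_nth_empty[OF assms]
    by (simp add: slice_point_def norm_eq_sqrt_inner inner_add_left inner_add_right inner_axis
        inner_axis' inner_axis_axis power2_eq_square)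
qed

lemma slice_point_paravector:
  assumes "J \<in> \<S>"
  shows "slice_point J x y \<in> paravectors"
proof -
  obtain u where "J = (\<Sum>i\<in>UNIV. u i *\<^sub>R \<e> {i})"
    using assms by (rule unit_sphereE)
  then have "slice_point J x y = x *\<^sub>R \<e> {} + (\<Sum>i\<in>UNIV. (y * u i) *\<^sub>R \<e> {i})"
    by (simp add: slice_point_def scaleR_sum_right)
  then show ?thesis
    unfolding paravectors_def by (intro CollectI exI[of _ x] exI[of _ "\<lambda>i. y * u i"] conjI TrueI)
qed

lemma pconj_slice_point:
  assumes "J \<in> \<S>"
  shows "pconj (slice_point J x y) = slice_point J x (- y)"
proof -
  obtain u where J: "J = (\<Sum>i\<in>UNIV. u i *\<^sub>R \<e> {i})"
    using assms by (rule unit_sphereE)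
  have "slice_point J x y $ {i} = y * u i" for i
    using generator_sum_nth(2)[of u i, folded J] by (simp add: slice_point_def axis_def)
  moreover have "(\<Sum>i\<in>UNIV. (y * u i) *\<^sub>R \<e> {i}) = y *\<^sub>R J"
    by (simp add: J scaleR_sum_right)
  ultimately show ?thesis
    by (simp only: pconj_def slice_point_nth_empty[OF assms]) (simp add: slice_point_def)
qed

section \<open>Real parts of points in double sectors\<close>

text \<open>The real part is \<open>r * cos \<psi>\<close> with \<open>\<psi>\<close> closer than
  \<open>\<omega>\<close> to 0 or \<open>pi\<close>. The bound turns exclusion from a sector into a
  comparison of cosines, and its weak form survives passage to the closure.\<close>

lemma double_sector_nth_empty:
  assumes "s \<in> double_sector \<omega>" "0 < \<omega>" "\<omega> < pi / 2"
  shows "\<bar>s $ {}\<bar> > cos \<omega> * norm s"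
proof -
  obtain r J \<psi> where s: "s = r *\<^sub>R cexp J \<psi>" "r > 0" "J \<in> \<S>" "\<psi> \<in> sector_angles \<omega>"
    using assms(1) by (auto simp: double_sector_def)
  have s': "s = slice_point J (r * cos \<psi>) (r * sin \<psi>)"
    by (simp add: s(1) cexp_def slice_point_def scaleR_add_right)
  have "norm s = sqrt (r\<^sup>2 * ((cos \<psi>)\<^sup>2 + (sin \<psi>)\<^sup>2))"
    unfolding s' norm_slice_point[OF s(3)] power_mult_distrib distrib_left ..
  then have "norm s = r"
    using s(2) by (simp add: sin_cos_squared_add2)
  moreover have "s $ {} = r * cos \<psi>"
    unfolding s' by (rule slice_point_nth_empty[OF s(3)])
  moreover have "\<bar>cos \<psi>\<bar> > cos \<omega>"
  proof (cases "\<psi> \<in> {- \<omega><..<\<omega>}")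
    case True
    then have "cos \<omega> < cos \<bar>\<psi>\<bar>"
      using assms by (intro cos_monotone_0_pi) auto
    then show ?thesis by simp
  next
    case False
    \<comment> \<open>The other half of the double sector is the first one turned by
      \<open>pi\<close>, which only changes the sign of the cosine.\<close>
    then have "cos \<omega> < cos \<bar>\<psi> - pi\<bar>"
      using assms s(4) by (intro cos_monotone_0_pi) (auto simp: sector_angles_def)
    then show ?thesis by (simp add: cos_diff)
  qed
  ultimately show ?thesis
    using s(2) by (simp add: abs_mult mult.commute)
qed

lemma closure_double_sector_nth_empty:
  fixes s :: "'n::finite clifford"
  assumes "s \<in> closure (double_sector \<omega>)" "0 < \<omega>" "\<omega> < pi / 2"
  shows "\<bar>s $ {}\<bar> \<ge> cos \<omega> * norm s"
proof -
  have "closed {s :: 'n clifford. cos \<omega> * norm s \<le> \<bar>s $ {}\<bar>}"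
    by (intro closed_Collect_le continuous_intros)
  moreover have "double_sector \<omega> \<subseteq> {s :: 'n clifford. cos \<omega> * norm s \<le> \<bar>s $ {}\<bar>}"
    using double_sector_nth_empty assms(2,3) by (auto intro: less_imp_le)
  ultimately show ?thesis
    using assms(1) closure_minimal by blast
qed

section \<open>Intrinsic functions on a slice\<close>

lemma clifford_mult_one: "(a :: 'n::{finite,linorder} clifford) \<odot> \<e> {} = a"
proof -
  have "a \<odot> \<e> {} = (\<Sum>A\<in>UNIV. a $ A *\<^sub>R (\<e> A \<odot> \<e> {}))"
    by (subst (1) basis_expansion_clifford[of a])
      (simp only: linear_sum[OF linear_lmul_left] linear_scale[OF linear_lmul_left])
  also have "\<dots> = (\<Sum>A\<in>UNIV. a $ A *\<^sub>R \<e> A)"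
    unfolding lmul_basis by (simp add: reorder_sign_def)
  finally show ?thesis
    by (simp flip: basis_expansion_clifford)
qed

text \<open>Real components keep the values inside \<open>\<complex>\<^sub>J\<close>, and their even
  and odd symmetry in \<open>y\<close> makes \<open>f\<close> compatible with conjugation.\<close>

lemma intrinsic_slice_point:
  assumes f: "f \<in> intrinsic U" and U: "(x, y) \<in> slice_domain U" "(x, - y) \<in> slice_domain U"
    and J: "J \<in> \<S>"
  obtains \<alpha> \<beta> where "f (slice_point J x y) = slice_point J \<alpha> \<beta>"
    "f (slice_point J x (- y)) = slice_point J \<alpha> (- \<beta>)"
proof -
  obtain f0 f1 where sc: "slice_components U f f0 f1"
    and re: "\<And>p. p \<in> slice_domain U \<Longrightarrow>
      f0 p \<in> range (\<lambda>r. r *\<^sub>R \<e> {}) \<and> f1 p \<in> range (\<lambda>r. r *\<^sub>R \<e> {})"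
    using f unfolding intrinsic_def by blast
  have rep: "f (slice_point J x' y') = f0 (x', y') + J \<odot> f1 (x', y')"
    "f0 (x', - y') = f0 (x', y')" "f1 (x', - y') = - f1 (x', y')"
    if "(x', y') \<in> slice_domain U" for x' y'
    using sc that J by (auto simp: slice_components_def slice_point_def)
  obtain \<alpha> \<beta> where "f0 (x, y) = \<alpha> *\<^sub>R \<e> {}" "f1 (x, y) = \<beta> *\<^sub>R \<e> {}"
    using re[OF U(1)] by blast
  then show thesis
    using rep(1)[OF U(1)] rep(1)[OF U(2)] rep(2,3)[OF U(1)]
    by (intro that[of \<alpha> \<beta>])
      (simp_all add: slice_point_def linear_scale[OF linear_lmul] linear_neg[OF linear_lmul]
        clifford_mult_one)
qed

section \<open>The integration path\<close>

text \<open>The real part depends on \<open>\<bar>t\<bar>\<close> and the imaginary part is odd in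
  \<open>t\<close>, so opposite parameters give conjugate points. At \<open>t = 0\<close> the factor
  \<open>\<bar>t\<bar>\<close> makes the path vanish.\<close>

lemma bisector_path_eq:
  "bisector_path \<sigma> J \<phi> t = slice_point J (\<sigma> * \<bar>t\<bar> * cos \<phi>) (- (\<sigma> * t * sin \<phi>))"
  by (cases t "0 :: real" rule: linorder_cases)
    (simp_all add: bisector_path_def cexp_def slice_point_def scaleR_diff_right scaleR_add_right)

lemma vector_derivative_bisector_path:
  assumes "t \<noteq> 0"
  shows "vector_derivative (bisector_path \<sigma> J \<phi>) (at t) =
    slice_point J (\<sigma> * sgn t * cos \<phi>) (- (\<sigma> * sin \<phi>))"
proof -
  \<comment> \<open>The open half line around \<open>t\<close>: there \<open>sgn\<close> is constant
    and the path is linear. The corner at 0 is avoided.\<close>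
  let ?S = "if t > 0 then {0<..} else {..<0 :: real}"
  have "((\<lambda>u. u *\<^sub>R slice_point J (\<sigma> * sgn t * cos \<phi>) (- (\<sigma> * sin \<phi>))) has_vector_derivative
      slice_point J (\<sigma> * sgn t * cos \<phi>) (- (\<sigma> * sin \<phi>))) (at t)"
    by (auto intro!: derivative_eq_intros)
  then have "(bisector_path \<sigma> J \<phi> has_vector_derivative
      slice_point J (\<sigma> * sgn t * cos \<phi>) (- (\<sigma> * sin \<phi>))) (at t)"
  proof (rule has_vector_derivative_transform_within_open[where S = ?S])
    show "open ?S" "t \<in> ?S"
      using assms by auto
  next
    fix u
    assume "u \<in> ?S"
    then have "sgn u = sgn t"
      using assms by (auto split: if_splits)
    then show "u *\<^sub>R slice_point J (\<sigma> * sgn t * cos \<phi>) (- (\<sigma> * sin \<phi>)) = bisector_path \<sigma> J \<phi> u"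
      by (simp add: bisector_path_eq slice_point_def scaleR_diff_right abs_sgn[of u] mult_ac)
  qed
  then show ?thesis
    by (rule vector_derivative_at)
qed

text \<open>This is the factor of \<open>ds\<^sub>J\<close>. Only its imaginary part contains
  \<open>sgn t\<close>, so it too is conjugated by \<open>t \<mapsto> - t\<close>.\<close>

lemma vector_derivative_bisector_path_div:
  assumes "t \<noteq> 0" "J \<in> \<S>"
  shows "vector_derivative (bisector_path \<sigma> J \<phi>) (at t) \<odot> (- J) =
    slice_point J (- (\<sigma> * sin \<phi>)) (- (\<sigma> * sgn t * cos \<phi>))"
  unfolding vector_derivative_bisector_path[OF assms(1)] slice_point_lmul
  by (simp add: slice_point_def linear_neg[OF linear_lmul] unit_sphere_square[OF assms(2)])

lemma bisector_path_in_slice_domain: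
  assumes "\<sigma> \<in> {1, - 1}" "t \<noteq> 0" "0 < \<phi>" "\<phi> < \<theta>"
  shows "(\<sigma> * \<bar>t\<bar> * cos \<phi>, - (\<sigma> * t * sin \<phi>)) \<in> slice_domain (double_sector \<theta>)"
proof -
  \<comment> \<open>For \<open>\<sigma> = - 1\<close> the sign is absorbed as a rotation by
    \<open>pi\<close>, leaving the positive radius \<open>\<bar>t\<bar>\<close>. The angle serves
    every \<open>K\<close> in the sphere at once.\<close>
  define \<psi> where "\<psi> = (if \<sigma> = 1 then - (sgn t * \<phi>) else pi - sgn t * \<phi>)"
  have "\<psi> \<in> sector_angles \<theta>"
    using assms by (auto simp: \<psi>_def sector_angles_def sgn_if)
  moreover have "(\<sigma> * \<bar>t\<bar> * cos \<phi>) *\<^sub>R \<e> {} + (- (\<sigma> * t * sin \<phi>)) *\<^sub>R K = \<bar>t\<bar> *\<^sub>R cexp K \<psi>" for K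
    using assms by (auto simp: cexp_def \<psi>_def scaleR_add_right sgn_if)
  ultimately show ?thesis
    using assms(2) by (force simp: slice_domain_def double_sector_def)
qed

lemma bisector_path_nth_empty:
  assumes "\<sigma> \<in> {1, - 1}" "J \<in> \<S>" "0 < \<phi>" "\<phi> < pi / 2"
  shows "norm (bisector_path \<sigma> J \<phi> t) = \<bar>t\<bar>"
    "\<bar>bisector_path \<sigma> J \<phi> t $ {}\<bar> = cos \<phi> * \<bar>t\<bar>"
proof -
  have "(\<sigma> * \<bar>t\<bar> * cos \<phi>)\<^sup>2 + (- (\<sigma> * t * sin \<phi>))\<^sup>2 = t\<^sup>2 * ((cos \<phi>)\<^sup>2 + (sin \<phi>)\<^sup>2)"
    unfolding distrib_left using assms(1) by (auto simp: power_mult_distrib)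
  then show "norm (bisector_path \<sigma> J \<phi> t) = \<bar>t\<bar>"
    by (simp add: bisector_path_eq norm_slice_point[OF assms(2)])
  have "cos \<phi> > 0"
    using assms by (intro cos_gt_zero_pi) auto
  then show "\<bar>bisector_path \<sigma> J \<phi> t $ {}\<bar> = cos \<phi> * \<bar>t\<bar>"
    using assms(1) by (auto simp: bisector_path_eq slice_point_nth_empty[OF assms(2)] abs_mult)
qed

text \<open>On the path the ratio of \<open>\<bar>s $ {}\<bar>\<close> to \<open>norm s\<close> is
  exactly \<open>cos \<phi>\<close>: too small for the strict bound in the sector of angle
  \<open>\<phi>\<close> and, as \<open>cos \<phi> < cos \<omega>\<close>, for the weak bound in the
  closure. The first exclusion gives bounded S-resolvents, the second bounded \<open>Q_inv\<close>
  and the hypotheses on \<open>A\<close>.\<close>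

lemma bisector_path_notin:
  assumes "\<sigma> \<in> {1, - 1}" "J \<in> \<S>" "0 < \<omega>" "\<omega> < \<phi>" "\<phi> < pi / 2" "t \<noteq> 0"
  shows "bisector_path \<sigma> J \<phi> t \<in> paravectors - (double_sector \<phi> \<union> {0})"
    "bisector_path \<sigma> J \<phi> t \<in> paravectors - closure (double_sector \<omega>)"
proof -
  let ?s = "bisector_path \<sigma> J \<phi> t"
  have \<phi>: "0 < \<phi>" using assms by simp
  note s = bisector_path_nth_empty[OF assms(1,2) \<phi> assms(5), of t]
  have p: "?s \<in> paravectors"
    by (simp add: bisector_path_eq slice_point_paravector assms(2))
  have "?s \<notin> double_sector \<phi>"
    using double_sector_nth_empty[of ?s \<phi>] s \<phi> assms by auto
  moreover have "?s \<noteq> 0"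
    using s(1) assms(6) by auto
  ultimately show "?s \<in> paravectors - (double_sector \<phi> \<union> {0})"
    using p by simp
  have "cos \<phi> < cos \<omega>"
    using assms by (intro cos_monotone_0_pi) auto
  then have "\<not> \<bar>?s $ {}\<bar> \<ge> cos \<omega> * norm ?s"
    using assms(6) by (simp add: s)
  then show "?s \<in> paravectors - closure (double_sector \<omega>)"
    using p closure_double_sector_nth_empty assms(3-5) by fastforce
qed

section \<open>Right-linear operators and the S-resolvent\<close>

lemma right_linear_scaleR:
  assumes "right_linear T" "T v = Some v'"
  shows "T (c *\<^sub>R v) = Some (c *\<^sub>R v')"
  using assms rmul_real unfolding right_linear_def by metis

lemma right_linear_add:
  assumes "right_linear T" "T v = Some v'" "T w = Some w'"
  shows "T (v + w) = Some (v' + w')"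
  using assms by (auto simp: right_linear_def)

lemma right_linear_map_comp:
  assumes "right_linear S" "right_linear T"
  shows "right_linear (S \<circ>\<^sub>m T)"
  using assms unfolding right_linear_def by (auto simp: map_comp_Some_iff)

lemma right_linear_total:
  assumes "right_linear T" "dom T = UNIV"
  shows "linear (\<lambda>v. the (T v))"
proof -
  have "\<exists>v'. T v = Some v'" for v
    using assms(2) by auto
  then show ?thesis
    by (intro linearI) (metis option.sel right_linear_add[OF assms(1)] right_linear_scaleR[OF assms(1)])+
qed

text \<open>Conjugate paravectors share real part and norm, so they lead to the same
  \<open>Q_inv\<close>.\<close>

lemma Q_op_cong: "s $ {} = s' $ {} \<Longrightarrow> norm s = norm s' \<Longrightarrow> Q_op s T = Q_op s' T"
  by (simp add: Q_op_def cong: if_cong)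

text \<open>The domain of a difference is the intersection of the two domains, so a total
  S-resolvent forces both of its terms to be total.\<close>

lemma left_S_resolvent_total:
  assumes "dom (left_S_resolvent s T) = UNIV"
  shows "dom (T \<circ>\<^sub>m Q_inv s T) = UNIV"
    "the (left_S_resolvent s T v) =
      the (Q_inv s T (pconj s \<odot> v)) - the ((T \<circ>\<^sub>m Q_inv s T) v)"
proof -
  have *: "v \<in> dom (Q_inv s T \<circ>\<^sub>m mult_op (pconj s)) \<inter> dom (T \<circ>\<^sub>m Q_inv s T)" for v
  proof -
    have "left_S_resolvent s T v \<noteq> None"
      using assms by blast
    then show ?thesis
      unfolding left_S_resolvent_def op_diff_def by (metis (no_types))
  qed
  then show "dom (T \<circ>\<^sub>m Q_inv s T) = UNIV"
    by blast
  show "the (left_S_resolvent s T v) =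
      the (Q_inv s T (pconj s \<odot> v)) - the ((T \<circ>\<^sub>m Q_inv s T) v)"
    using *[of v] by (simp add: left_S_resolvent_def op_diff_def mult_op_def)
qed

text \<open>
  The terms at \<open>s\<close> and at its conjugate add up to a \<^emph>\<open>real\<close> combination, which is why no
  commutation of \<open>A\<close> with left multiplications is needed.
\<close>

lemma left_S_resolvent_add_conj:
  fixes T :: "('v::real_normed_vector, 'n::{finite,linorder}) clifford_operator"
  assumes J: "J \<in> \<S>" and s: "s = slice_point J x y" and s': "s' = slice_point J x (- y)"
    and T: "right_linear T" "Q_inv s T \<in> bounded_ops"
    and R: "left_S_resolvent s T \<in> bounded_ops" "left_S_resolvent s' T \<in> bounded_ops"
  obtains c d where "\<And>v.
    the (left_S_resolvent s T (slice_point J p q \<odot> slice_point J \<alpha> \<beta> \<odot> v)) +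
    the (left_S_resolvent s' T (slice_point J p (- q) \<odot> slice_point J \<alpha> (- \<beta>) \<odot> v)) =
    c *\<^sub>R the (Q_inv s T v) + d *\<^sub>R the ((T \<circ>\<^sub>m Q_inv s T) v)"
proof -
  define P where "P = (\<lambda>v. the (Q_inv s T v))"
  define N where "N = (\<lambda>v. the ((T \<circ>\<^sub>m Q_inv s T) v))"
  have Q': "Q_inv s' T = Q_inv s T"
    using Q_op_cong[of s' s T] by (simp add: s s' J slice_point_nth_empty norm_slice_point)
  have R': "dom (left_S_resolvent s T) = UNIV" "dom (left_S_resolvent s' T) = UNIV"
    using R by (auto simp: bounded_ops_def)
  have res: "the (left_S_resolvent s T v) = P (slice_point J x (- y) \<odot> v) - N v"
    "the (left_S_resolvent s' T v) = P (slice_point J x y \<odot> v) - N v" for v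
    using left_S_resolvent_total(2)[OF R'(1)] left_S_resolvent_total(2)[OF R'(2)]
    unfolding P_def N_def Q' by (simp_all add: s s' pconj_slice_point[OF J])
  have Q: "right_linear (Q_inv s T)" "dom (Q_inv s T) = UNIV"
    using T(2) by (auto simp: bounded_ops_def)
  have P: "linear P"
    unfolding P_def by (rule right_linear_total[OF Q])
  have N: "linear N"
    unfolding N_def
    by (rule right_linear_total[OF right_linear_map_comp[OF T(1) Q(1)] left_S_resolvent_total(1)[OF R'(1)]])
  \<comment> \<open>The imaginary parts cancel before \<open>L\<close> meets them, so real linearity
    of \<open>L\<close> suffices.\<close>
  have sum: "L (slice_point J a b \<odot> v) + L (slice_point J a (- b) \<odot> v) = (2 * a) *\<^sub>R L v"
    if "linear L" for L :: "('v, 'n) clifford_module \<Rightarrow> ('v, 'n) clifford_module" and a b v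
    by (simp add: slice_point_lmul linear_add[OF that] linear_diff[OF that] linear_scale[OF that]
        flip: scaleR_2)
  \<comment> \<open>\<open>u + J w\<close> is the product of the two slice factors; multiplying it
    by the conjugate of \<open>s\<close> gives real part \<open>x * u + y * w\<close> and imaginary
    part \<open>x * w - y * u\<close>.\<close>
  define u where "u = p * \<alpha> - q * \<beta>"
  define w where "w = p * \<beta> + q * \<alpha>"
  have "the (left_S_resolvent s T (slice_point J p q \<odot> slice_point J \<alpha> \<beta> \<odot> v)) +
    the (left_S_resolvent s' T (slice_point J p (- q) \<odot> slice_point J \<alpha> (- \<beta>) \<odot> v)) =
    (2 * (x * u + y * w)) *\<^sub>R P v + (- 2 * u) *\<^sub>R N v" for v
  proof -
    have "the (left_S_resolvent s T (slice_point J p q \<odot> slice_point J \<alpha> \<beta> \<odot> v)) +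
      the (left_S_resolvent s' T (slice_point J p (- q) \<odot> slice_point J \<alpha> (- \<beta>) \<odot> v)) =
      (P (slice_point J (x * u + y * w) (x * w - y * u) \<odot> v) +
       P (slice_point J (x * u + y * w) (- (x * w - y * u)) \<odot> v)) -
      (N (slice_point J u w \<odot> v) + N (slice_point J u (- w) \<odot> v))"
      unfolding res slice_point_mult[OF J] by (simp add: u_def w_def algebra_simps)
    then show ?thesis
      unfolding sum[OF P] sum[OF N] by simp
  qed
  then show thesis
    unfolding P_def N_def by (rule that)
qed

section \<open>The integrand of the calculus\<close>

definition omega_integrand :: "real \<Rightarrow> 'n clifford \<Rightarrow> real \<Rightarrow> ('n clifford \<Rightarrow> 'n clifford) \<Rightarrow>
    ('v::real_normed_vector, 'n::{finite,linorder}) clifford_operator \<Rightarrow> real \<Rightarrow>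
    ('v, 'n) clifford_module \<Rightarrow>\<^sub>L ('v, 'n) clifford_module"
  where "omega_integrand \<sigma> J \<phi> f T t =
    (let s = bisector_path \<sigma> J \<phi> t;
         ds = vector_derivative (bisector_path \<sigma> J \<phi>) (at t) \<odot> (- J)
     in Blinfun (\<lambda>v. the ((left_S_resolvent s T \<circ>\<^sub>m mult_op ds \<circ>\<^sub>m mult_op (f s)) v)))"

lemma omega_calculus_eq:
  "omega_calculus \<phi> J f T =
    (1 / (2 * pi)) *\<^sub>R (\<Sum>\<sigma>\<in>{1, - 1}. integral UNIV (omega_integrand \<sigma> J \<phi> f T))"
  unfolding omega_calculus_def omega_integrand_def ..

text \<open>\<open>Blinfun\<close> returns the intended map only for bounded linear arguments; here
  the S-resolvent is bounded by assumption and left multiplications always are.\<close>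

lemma omega_integrand_apply:
  fixes T :: "('v::real_normed_vector, 'n::{finite,linorder}) clifford_operator"
  assumes "left_S_resolvent (bisector_path \<sigma> J \<phi> t) T \<in> bounded_ops"
  shows "blinfun_apply (omega_integrand \<sigma> J \<phi> f T t) v =
    the (left_S_resolvent (bisector_path \<sigma> J \<phi> t) T
      ((vector_derivative (bisector_path \<sigma> J \<phi>) (at t) \<odot> (- J)) \<odot>
        f (bisector_path \<sigma> J \<phi> t) \<odot> v))"
proof -
  have "bounded_linear (\<lambda>v. the (left_S_resolvent (bisector_path \<sigma> J \<phi> t) T v))"
    using assms by (simp add: bounded_ops_def)
  note bounded_linear_compose[OF this
      bounded_linear_compose[OF bounded_linear_lmul bounded_linear_lmul]]
  then show ?thesis
    by (simp add: omega_integrand_def Let_def mult_op_def bounded_linear_Blinfun_apply)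
qed

section \<open>Commutation of \<open>A\<close> with the functional calculus\<close>

text \<open>The condition says that \<open>(B v, B w)\<close> lies in the graph of \<open>A\<close>,
  a real subspace, and this pair depends linearly on \<open>B\<close>.\<close>

lemma subspace_commuting:
  assumes "right_linear A"
  shows "subspace {B :: ('v::real_normed_vector, 'n::{finite,linorder}) clifford_module \<Rightarrow>\<^sub>L
    ('v, 'n) clifford_module. A (blinfun_apply B v) = Some (blinfun_apply B w)}"
  using assms right_linear_add[OF assms] right_linear_scaleR[OF assms]
  by (auto simp: subspace_def blinfun.add_left blinfun.scaleR_left right_linear_def)

text \<open>Evaluation at \<open>v\<close> and \<open>w\<close> is continuous in the operator norm,
  so the set is the preimage of a closed graph.\<close>

lemma closed_commuting:
  assumes "closed (Map.graph A)"
  shows "closed {B :: ('v::real_normed_vector, 'n::{finite,linorder}) clifford_module \<Rightarrow>\<^sub>L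
    ('v, 'n) clifford_module. A (blinfun_apply B v) = Some (blinfun_apply B w)}"
proof -
  have "closed ((\<lambda>B. (blinfun_apply B v, blinfun_apply B w)) -` Map.graph A)"
    using assms by (intro continuous_closed_vimage) (auto intro!: continuous_intros)
  then show ?thesis
    by (simp add: Map.graph_def vimage_def)
qed

theorem theorem3p17:
  fixes T A :: "('v::banach, 'n::{finite,linorder}) clifford_operator"
    and g :: "'n clifford \<Rightarrow> 'n clifford"
    and J :: "'n clifford"
    and \<omega> \<theta> \<phi> :: real
  assumes "\<omega> \<in> {0<..<pi / 2}"
    and "bisectorial \<omega> T"
    and "A \<in> closed_ops"
    and "\<And>s. s \<in> paravectors - closure (double_sector \<omega>) \<Longrightarrow>
      Q_inv s T \<circ>\<^sub>m A \<subseteq>\<^sub>m A \<circ>\<^sub>m Q_inv s T"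
    and "\<And>s. s \<in> paravectors - closure (double_sector \<omega>) \<Longrightarrow>
      T \<circ>\<^sub>m Q_inv s T \<circ>\<^sub>m A \<subseteq>\<^sub>m A \<circ>\<^sub>m T \<circ>\<^sub>m Q_inv s T"
    and "\<theta> \<in> {\<omega><..<pi / 2}"
    and "g \<in> N0 \<theta>"
    and "\<phi> \<in> {\<omega><..<\<theta>}" and "J \<in> \<S>"
  shows "op_of_blinfun (omega_calculus \<phi> J g T) \<circ>\<^sub>m A
    \<subseteq>\<^sub>m A \<circ>\<^sub>m op_of_blinfun (omega_calculus \<phi> J g T)"
proof -
  have \<phi>: "0 < \<omega>" "\<omega> < \<phi>" "\<phi> < \<theta>" "\<phi> < pi / 2" "0 < \<phi>"
    using assms(1,6,8) by auto
  note J = \<open>J \<in> \<S>\<close>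
  have T: "right_linear T"
    using assms(2) by (simp add: bisectorial_def closed_ops_def)
  have A: "right_linear A" "closed (Map.graph A)"
    using assms(3) by (simp_all add: closed_ops_def)
  have R: "left_S_resolvent s T \<in> bounded_ops" if "s \<in> paravectors - (double_sector \<phi> \<union> {0})" for s
    using assms(2) that \<phi> by (fastforce simp: bisectorial_def)
  have Q: "Q_inv s T \<in> bounded_ops" if "s \<in> paravectors - closure (double_sector \<omega>)" for s
    using assms(2) that by (auto simp: bisectorial_def S_spectrum_def S_resolvent_set_def)
  \<comment> \<open>The operator inclusion, read pointwise: for each pair \<open>(v, w)\<close> in
    the graph of \<open>A\<close>, the calculus maps it into the graph again.\<close>
  have "A (blinfun_apply (omega_calculus \<phi> J g T) v) =
      Some (blinfun_apply (omega_calculus \<phi> J g T) w)" if Av: "A v = Some w" for v w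
  proof -
    define M where "M = {B :: ('v, 'n) clifford_module \<Rightarrow>\<^sub>L ('v, 'n) clifford_module.
      A (blinfun_apply B v) = Some (blinfun_apply B w)}"
    have M: "subspace M" "closed M"
      unfolding M_def by (rule subspace_commuting[OF A(1)], rule closed_commuting[OF A(2)])
    have "integral UNIV (omega_integrand \<sigma> J \<phi> g T) \<in> M" if \<sigma>: "\<sigma> \<in> {1, - 1}" for \<sigma>
    proof (cases "omega_integrand \<sigma> J \<phi> g T integrable_on UNIV")
      case False
      \<comment> \<open>the integral has the junk value \<open>0\<close>, so convergence need not be proved\<close>
      then show ?thesis
        by (simp add: not_integrable_integral subspace_0[OF M(1)])
    next
      case True
      define F where "F = omega_integrand \<sigma> J \<phi> g T"
      have F: "(F has_integral integral UNIV F) UNIV"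
        using True unfolding F_def by (rule integrable_integral)
      have "F t + F (- t) \<in> M" if t: "t \<noteq> 0" for t
      proof -
        have t': "- t \<noteq> 0" using t by simp
        define x where "x = \<sigma> * \<bar>t\<bar> * cos \<phi>"
        define y where "y = - (\<sigma> * t * sin \<phi>)"
        let ?s = "bisector_path \<sigma> J \<phi> t" and ?s' = "bisector_path \<sigma> J \<phi> (- t)"
        have s: "?s = slice_point J x y" "?s' = slice_point J x (- y)"
          by (simp_all add: bisector_path_eq x_def y_def)
        have "(x, y) \<in> slice_domain (double_sector \<theta>)" "(x, - y) \<in> slice_domain (double_sector \<theta>)"
          using bisector_path_in_slice_domain[OF \<sigma> t \<phi>(5,3)]
            bisector_path_in_slice_domain[OF \<sigma> t' \<phi>(5,3)] by (simp_all add: x_def y_def)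
        moreover have "g \<in> intrinsic (double_sector \<theta>)"
          using assms(7) by (simp add: N0_def)
        ultimately obtain \<alpha> \<beta> where
          g: "g ?s = slice_point J \<alpha> \<beta>" "g ?s' = slice_point J \<alpha> (- \<beta>)"
          using intrinsic_slice_point[OF _ _ _ J] unfolding s by metis
        note notin = bisector_path_notin[OF \<sigma> J \<phi>(1,2,4)]
        note R = R[OF notin(1)[OF t]] R[OF notin(1)[OF t']]
        \<comment> \<open>The four parameters are the real and imaginary parts of the
          \<open>ds\<^sub>J\<close> factor and of \<open>g ?s\<close>. Passing to \<open>- t\<close>
          flips \<open>sgn t\<close> and yields the conjugate factors.\<close>
        obtain c d where cd: "\<And>u. blinfun_apply (F t) u + blinfun_apply (F (- t)) u =
            c *\<^sub>R the (Q_inv ?s T u) + d *\<^sub>R the ((T \<circ>\<^sub>m Q_inv ?s T) u)"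
          using left_S_resolvent_add_conj[OF J s T Q[OF notin(2)[OF t]] R,
              of "- (\<sigma> * sin \<phi>)" "- (\<sigma> * sgn t * cos \<phi>)" \<alpha> \<beta>]
          unfolding F_def omega_integrand_apply[OF R(1)] omega_integrand_apply[OF R(2)] g
            vector_derivative_bisector_path_div[OF t J] vector_derivative_bisector_path_div[OF t' J]
          by (simp add: sgn_minus) blast
        have dom: "dom (Q_inv ?s T) = UNIV" "dom (T \<circ>\<^sub>m Q_inv ?s T) = UNIV"
          using Q[OF notin(2)[OF t]] R(1) left_S_resolvent_total(1)[of ?s T]
          by (simp_all add: bounded_ops_def)
        \<comment> \<open>Because \<open>B\<close> is total, \<open>w\<close> lies in the domain of
          \<open>B\<close>, so \<open>v\<close> lies in that of the smaller product and the
          inclusion can be evaluated there.\<close>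
        have comm: "A (the (B v)) = Some (the (B w))" if B: "B \<circ>\<^sub>m A \<subseteq>\<^sub>m A \<circ>\<^sub>m B" "dom B = UNIV" for B
        proof -
          obtain v' w' where Bv: "B v = Some v'" "B w = Some w'"
            using B(2) by blast
          then have "(B \<circ>\<^sub>m A) v = Some w'"
            using Av by simp
          then have "(A \<circ>\<^sub>m B) v = Some w'"
            using B(1) by (force simp: map_le_def dom_def)
          then show ?thesis
            using Bv by simp
        qed
        \<comment> \<open>\<open>\<circ>\<^sub>m\<close> associates to the left, so the second
          hypothesis must be regrouped to show \<open>T \<circ>\<^sub>m B\<close> as one
          operator.\<close>
        have assoc: "A \<circ>\<^sub>m T \<circ>\<^sub>m B = A \<circ>\<^sub>m (T \<circ>\<^sub>m B)" for B :: "('v, 'n) clifford_operator"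
          by (auto simp: map_comp_def split: option.splits)
        have "A (the (Q_inv ?s T v)) = Some (the (Q_inv ?s T w))"
          using assms(4)[OF notin(2)[OF t]] dom(1) by (rule comm)
        moreover have "A (the ((T \<circ>\<^sub>m Q_inv ?s T) v)) = Some (the ((T \<circ>\<^sub>m Q_inv ?s T) w))"
          using assms(5)[OF notin(2)[OF t]] dom(2) unfolding assoc by (rule comm)
        ultimately show ?thesis
          by (simp add: M_def blinfun.add_left cd right_linear_add right_linear_scaleR A(1))
      qed
      \<comment> \<open>Reflection preserves the integral, so folding doubles it. At the corner
        \<open>t = 0\<close> the value is replaced by 0, which lies in \<open>M\<close> and leaves
        the integral unchanged.\<close>
      moreover have "((\<lambda>t. if t = 0 then 0 else F t + F (- t)) has_integral
          integral UNIV F + integral UNIV F) UNIV"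
        by (rule has_integral_spike_finite[OF _ _
              has_integral_add[OF F has_integral_reflect_UNIV[OF F]], of "{0}"]) auto
      ultimately have "integral UNIV F + integral UNIV F \<in> M"
        by (elim has_integral_in_closed_subspace) (auto simp: M subspace_0)
      then have "(1 / 2) *\<^sub>R (2 *\<^sub>R integral UNIV F) \<in> M"
        unfolding scaleR_2 by (rule subspace_scale[OF M(1)])
      then show ?thesis
        by (simp add: F_def)
    qed
    then have "omega_calculus \<phi> J g T \<in> M"
      unfolding omega_calculus_eq by (intro subspace_scale subspace_sum M)
    then show ?thesis
      by (simp add: M_def)
  qed
  then show ?thesis
    by (auto simp: map_le_def op_of_blinfun_def map_comp_def split: option.splits)
qed

end
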